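(* The Lorenz product is commutative and associative: for all Lorenz hulls $H_1,H_2,H_3\subseteq\mathbb{R}^n$, $H_1H_2=H_2H_1$ and $(H_1H_2)H_3=H_1(H_2H_3)$.
   Context: An $n$-dimensional finite signed vector measure on a measurable space $(S,\mathcal{F})$ is an $n$-tuple $\boldsymbol{\mu}=(\mu_1,\dots,\mu_n)$ of finite signed measures on $(S,\mathcal{F})$, viewed as a map $\boldsymbol{\mu}:\mathcal{F}\to\mathbb{R}^n$. Its Lorenz hull $\mathsf{LH}(\boldsymbol{\mu})$ is the convex hull of its range $\{\boldsymbol{\mu}(A):A\in\mathcal{F}\}$. A Lorenz hull in $\mathbb{R}^n$ is a set of the form $\mathsf{LH}(\boldsymbol{\mu})$ for some such $\boldsymbol{\mu}$ on some measurable space. For $n$-dimensional finite signed vector measures $\boldsymbol{\alpha}=(\alpha_1,\dots,\alpha_n)$ on $(S,\mathcal{F})$ and $\boldsymbol{\beta}=(\beta_1,\dots,\beta_n)$ on $(T,\mathcal{G})$, $\boldsymbol{\alpha}\times\boldsymbol{\beta}:=(\alpha_1\times\beta_1,\dots,\alpha_n\times\beta_n)$ on the product measurable space, where $\alpha_i\times\beta_i$ is the unique finite signed measure with $(\alpha_i\times\beta_i)(A\times B)=\alpha_i(A)\beta_i(B)$ for all $A\in\mathcal{F}$, $B\in\mathcal{G}$. The Lorenz product of Lorenz hulls $H=\mathsf{LH}(\boldsymbol{\alpha})$ and $H'=\mathsf{LH}(\boldsymbol{\beta})$ is $HH':=\mathsf{LH}(\boldsymbol{\alpha}\times\boldsymbol{\beta})$;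 this set depends only on $H$ and $H'$, so the product is well defined. *)

theory Defs
  imports "HOL-Analysis.Analysis"
begin

text \<open>Throughout, a term \<open>M :: 'a measure\<close> only plays the role of the measurable space
  \<open>(space M, sets M)\<close>; its own measure is never used. A set function is only meaningful on
  \<open>sets M\<close>.\<close>

definition finite_signed_measure :: "'a measure \<Rightarrow> ('a set \<Rightarrow> real) \<Rightarrow> bool" where
  "finite_signed_measure M \<mu> \<longleftrightarrow>
     \<mu> {} = 0 \<and>
     (\<forall>A :: nat \<Rightarrow> 'a set. range A \<subseteq> sets M \<longrightarrow> disjoint_family A \<longrightarrow>
        (\<lambda>i. \<mu> (A i)) sums \<mu> (\<Union>i. A i))"

text \<open>The requirement that the product vanish off the product sigma-algebra only makes the set
  function unique as a total function.\<close>

definition signed_prod ::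
  "'a measure \<Rightarrow> ('a set \<Rightarrow> real) \<Rightarrow> 'b measure \<Rightarrow> ('b set \<Rightarrow> real) \<Rightarrow> ('a \<times> 'b) set \<Rightarrow> real" where
  "signed_prod M \<mu> N \<nu> = (THE \<pi>.
     finite_signed_measure (M \<Otimes>\<^sub>M N) \<pi> \<and>
     (\<forall>A \<in> sets M. \<forall>B \<in> sets N. \<pi> (A \<times> B) = \<mu> A * \<nu> B) \<and>
     (\<forall>C. C \<notin> sets (M \<Otimes>\<^sub>M N) \<longrightarrow> \<pi> C = 0))"

definition signed_vector_measure :: "'a measure \<Rightarrow> ('a set \<Rightarrow> real ^ 'n) \<Rightarrow> bool" where
  "signed_vector_measure M \<mu> \<longleftrightarrow> (\<forall>i. finite_signed_measure M (\<lambda>A. \<mu> A $ i))"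

definition vector_prod ::
  "'a measure \<Rightarrow> ('a set \<Rightarrow> real ^ 'n) \<Rightarrow> 'b measure \<Rightarrow> ('b set \<Rightarrow> real ^ 'n)
     \<Rightarrow> ('a \<times> 'b) set \<Rightarrow> real ^ 'n" where
  "vector_prod M \<alpha> N \<beta> = (\<lambda>C. \<chi> i. signed_prod M (\<lambda>A. \<alpha> A $ i) N (\<lambda>B. \<beta> B $ i) C)"

definition lorenz_hull :: "'a measure \<Rightarrow> ('a set \<Rightarrow> real ^ 'n) \<Rightarrow> (real ^ 'n) set" where
  "lorenz_hull M \<mu> = convex hull (\<mu> ` sets M)"

text \<open>HOL cannot quantify over the carrier types of the representing vector measures inside a
  definition, so representatives are taken on measurable spaces carried by subsets of
  \<open>real ^ 'n\<close>. No Lorenz hull is lost: let \<open>f\<close> be the density of \<open>\<mu>\<close> with respect to the sum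
  \<open>\<tau>\<close> of the total variations of its components; the vector measure on the Borel sets of
  \<open>real ^ 'n\<close> whose density with respect to the image of \<open>\<tau>\<close> under \<open>f\<close> is the identity has
  the same Lorenz hull as \<open>\<mu>\<close>.\<close>

definition lorenz_prod :: "(real ^ 'n) set \<Rightarrow> (real ^ 'n) set \<Rightarrow> (real ^ 'n) set"
    (infixl "\<odot>\<^sub>L" 70) where
  "H \<odot>\<^sub>L H' = (THE K. \<exists>(M :: (real ^ 'n) measure) \<alpha> (N :: (real ^ 'n) measure) \<beta>.
     signed_vector_measure M \<alpha> \<and> signed_vector_measure N \<beta> \<and>
     H = lorenz_hull M \<alpha> \<and> H' = lorenz_hull N \<beta> \<and>
     K = lorenz_hull (M \<Otimes>\<^sub>M N) (vector_prod M \<alpha> N \<beta>))"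

end

theory Submission
  imports Defs
begin

text \<open>Every vector measure has the form \<open>\<mu>(A) = \<integral>\<^sub>A f d\<sigma>\<close> with a finite positive measure
  \<open>\<sigma>\<close> and an integrable density \<open>f\<close> (Jordan decomposition and Radon--Nikodym:
  \<open>signed_vector_measure_density\<close>). The linear functional \<open>u\<close> is maximised over its range at
  \<open>{u \<bullet> f > 0}\<close>, so the support function of the Lorenz hull is
  \<open>u \<mapsto> \<integral> max 0 (u \<bullet> f) d\<sigma>\<close>.

  A convex set is determined by its support function only up to closure, so the Lorenz hull must
  be shown to be closed (\<open>closed_density_hull\<close>). This is a weak form of Lyapunov's theorem. A limit
  point outside the hull would lie on a supporting hyperplane, orthogonal to some \<open>u\<close>, and maximising
  sequences converge to the indicator of \<open>{u \<bullet> f > 0}\<close> off \<open>{u \<bullet> f = 0}\<close>; on the latter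
  set \<open>f\<close> takes values in a space of smaller dimension, and induction applies.

  The product of vector measures with densities \<open>f\<close> and \<open>g\<close> has the componentwise product
  \<open>f(x) * g(y)\<close> as its density (\<open>has_density_vector_prod\<close>). Since
  \<open>u \<bullet> (f(x) * g(y)) = (u * g(y)) \<bullet> f(x)\<close>, Fubini's theorem writes the support function of the product
  as an integral of the support function of either factor (\<open>support_prod\<close>). Hence the product hull
  depends only on the two hulls, and commutativity and associativity are those of iterated integrals.
  Finally, replacing \<open>\<sigma>\<close> by its image under \<open>f\<close> realises every Lorenz hull on the Borel sets
  of the vector space itself (\<open>lorenz_hull_on_vectors\<close>), so the description of the Lorenz product
  by such representatives is not vacuous.\<close>

section \<open>Jordan decomposition of finite signed measures\<close>

lemma finite_signed_measure_sums:
  assumes "finite_signed_measure M \<mu>" "\<And>i. A i \<in> sets M" "disjoint_family (A :: nat \<Rightarrow> _)"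
  shows "(\<lambda>i. \<mu> (A i)) sums \<mu> (\<Union>i. A i)"
  using assms unfolding finite_signed_measure_def by blast

lemma finite_signed_measure_Un:
  assumes \<mu>: "finite_signed_measure M \<mu>" and A: "A \<in> sets M" and B: "B \<in> sets M"
    and "A \<inter> B = {}"
  shows "\<mu> (A \<union> B) = \<mu> A + \<mu> B"
proof -
  have "\<mu> {} = 0" using \<mu> by (simp add: finite_signed_measure_def)
  then have 1: "(\<lambda>i. \<mu> (binaryset A B i)) sums (\<mu> A + \<mu> B)"
    by (rule binaryset_sums)
  have "disjoint_family (binaryset A B)"
    unfolding disjoint_family_on_def binaryset_def using assms(4) by auto
  then have "(\<lambda>i. \<mu> (binaryset A B i)) sums \<mu> (\<Union>i. binaryset A B i)"
    by (rule finite_signed_measure_sums[OF \<mu>, rotated]) (use A B in \<open>simp add: binaryset_def\<close>)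
  with 1 show ?thesis by (metis UN_binaryset_eq sums_unique2)
qed

lemma finite_signed_measure_Diff:
  assumes "finite_signed_measure M \<mu>" and "A \<in> sets M" and "B \<in> sets M" and "B \<subseteq> A"
  shows "\<mu> (A - B) = \<mu> A - \<mu> B"
proof -
  have "\<mu> (B \<union> (A - B)) = \<mu> B + \<mu> (A - B)"
    by (rule finite_signed_measure_Un[OF assms(1)]) (use assms in auto)
  then show ?thesis using assms(4) by (simp add: Un_absorb1)
qed

lemma finite_signed_measure_diff:
  "finite_signed_measure M \<mu> \<Longrightarrow> finite_signed_measure M \<nu>
    \<Longrightarrow> finite_signed_measure M (\<lambda>A. \<mu> A - \<nu> A)"
  unfolding finite_signed_measure_def by (auto intro!: sums_diff)

lemma finite_signed_measure_add:
  "finite_signed_measure M \<mu> \<Longrightarrow> finite_signed_measure M \<nu>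
    \<Longrightarrow> finite_signed_measure M (\<lambda>A. \<mu> A + \<nu> A)"
  unfolding finite_signed_measure_def by (auto intro!: sums_add)

lemma finite_signed_measure_sum:
  assumes "\<And>i. i \<in> I \<Longrightarrow> finite_signed_measure M (\<mu> i)"
  shows "finite_signed_measure M (\<lambda>A. \<Sum>i\<in>I. \<mu> i A)"
  using assms unfolding finite_signed_measure_def by (auto intro!: sums_sum)

text \<open>If \<open>\<mu>\<close> were unbounded on the measurable subsets of \<open>A\<close>, then \<open>A\<close> could be split into
  two parts on both of which \<open>\<bar>\<mu>\<bar> > 1\<close>, and \<open>\<mu>\<close> would be unbounded on one of them. Keeping
  that part and repeating would produce disjoint sets with \<open>\<bar>\<mu>\<bar> > 1\<close>, against the
  convergence of the series in countable additivity.\<close>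

lemma finite_signed_measure_bounded:
  assumes \<mu>: "finite_signed_measure M \<mu>"
  obtains K where "\<And>B. B \<in> sets M \<Longrightarrow> \<bar>\<mu> B\<bar> \<le> K"
proof -
  define bad where
    "bad A \<longleftrightarrow> A \<in> sets M \<and> (\<forall>K. \<exists>B\<in>sets M. B \<subseteq> A \<and> \<bar>\<mu> B\<bar> > K)" for A
  have bad_D: "\<exists>B. B \<in> sets M \<and> B \<subseteq> A \<and> \<bar>\<mu> B\<bar> > K" if "bad A" for A K
    using that by (auto simp: bad_def)
  have not_bad: "\<exists>K. \<forall>D\<in>sets M. D \<subseteq> A \<longrightarrow> \<bar>\<mu> D\<bar> \<le> K" if "\<not> bad A" "A \<in> sets M" for A
    using that by (simp add: bad_def not_less)
  have step: "\<exists>A'. bad A' \<and> A' \<subseteq> A \<and> \<bar>\<mu> (A - A')\<bar> > 1" if "bad A" for A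
  proof -
    have A: "A \<in> sets M" using that by (simp add: bad_def)
    obtain B where B: "B \<in> sets M" "B \<subseteq> A" "\<bar>\<mu> B\<bar> > 1 + \<bar>\<mu> A\<bar>"
      using bad_D[OF \<open>bad A\<close>] by blast
    have d: "\<mu> (A - B) = \<mu> A - \<mu> B" by (rule finite_signed_measure_Diff[OF \<mu> A B(1,2)])
    show ?thesis
    proof (cases "bad B")
      case True
      have "\<bar>\<mu> (A - B)\<bar> > 1" using d B(3) by linarith
      with True B show ?thesis by blast
    next
      case False
      then obtain K1 where K1: "\<And>D. D \<in> sets M \<Longrightarrow> D \<subseteq> B \<Longrightarrow> \<bar>\<mu> D\<bar> \<le> K1"
        using not_bad[OF False B(1)] by blast
      have "bad (A - B)"
      proof (rule ccontr)
        assume "\<not> bad (A - B)"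
        then obtain K2 where K2: "\<And>D. D \<in> sets M \<Longrightarrow> D \<subseteq> A - B \<Longrightarrow> \<bar>\<mu> D\<bar> \<le> K2"
          using not_bad[of "A - B"] A B(1) by blast
        obtain D where D: "D \<in> sets M" "D \<subseteq> A" "\<bar>\<mu> D\<bar> > K1 + K2"
          using bad_D[OF \<open>bad A\<close>] by blast
        have "\<mu> ((D \<inter> B) \<union> (D - B)) = \<mu> (D \<inter> B) + \<mu> (D - B)"
          by (rule finite_signed_measure_Un[OF \<mu>]) (use D B in auto)
        moreover have "(D \<inter> B) \<union> (D - B) = D" by blast
        moreover have "\<bar>\<mu> (D \<inter> B)\<bar> \<le> K1" by (rule K1) (use D B in auto)
        moreover have "\<bar>\<mu> (D - B)\<bar> \<le> K2" by (rule K2) (use D B in auto)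
        ultimately show False using D(3) by simp
      qed
      moreover have "A - (A - B) = B" using B by blast
      moreover have "\<bar>\<mu> B\<bar> > 1" using B(3) by linarith
      ultimately show ?thesis by (metis Diff_subset)
    qed
  qed
  have "\<not> bad (space M)"
  proof
    assume "bad (space M)"
    then obtain A where A: "\<And>n::nat. bad (A n)"
      "\<And>n. A (Suc n) \<subseteq> A n \<and> \<bar>\<mu> (A n - A (Suc n))\<bar> > 1"
      using dependent_nat_choice[of "\<lambda>_. bad" "\<lambda>_ A A'. A' \<subseteq> A \<and> \<bar>\<mu> (A - A')\<bar> > 1"] step
      by metis
    define E where "E n = A n - A (Suc n)" for n
    have dec: "A m \<subseteq> A n" if "n \<le> m" for m n
      by (rule lift_Suc_antimono_le[of A, OF conjunct1[OF A(2)] that])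
    have "disjoint_family E"
    unfolding disjoint_family_on_def
    proof (intro ballI impI)
      have *: "E m \<inter> E n = {}" if "m < n" for m n
        using dec[of "Suc m" n] that unfolding E_def by auto
      show "E m \<inter> E n = {}" if "m \<noteq> n" for m n
        using *[of m n] *[of n m] that by (cases "m < n") auto
    qed
    moreover have "E n \<in> sets M" for n
      using A(1) unfolding E_def bad_def by auto
    ultimately have "(\<lambda>n. \<mu> (E n)) sums \<mu> (\<Union>n. E n)"
      by (intro finite_signed_measure_sums[OF \<mu>])
    then have "(\<lambda>n. \<mu> (E n)) \<longlonglongrightarrow> 0"
      using sums_summable summable_LIMSEQ_zero by blast
    then have "eventually (\<lambda>n. \<bar>\<mu> (E n)\<bar> < 1) sequentially"
      using order_tendstoD(2)[OF tendsto_rabs_zero, of _ _ 1] by simp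
    then obtain n where "\<bar>\<mu> (E n)\<bar> < 1" using eventually_happens'[OF sequentially_bot] by blast
    then show False using A(2)[of n] unfolding E_def by linarith
  qed
  then obtain K where "\<forall>D\<in>sets M. D \<subseteq> space M \<longrightarrow> \<bar>\<mu> D\<bar> \<le> K"
    using not_bad by blast
  then show thesis by (intro that[of K]) (simp add: sets.sets_into_space)
qed

text \<open>The positive part is \<open>p A = Sup {\<mu> B | B \<subseteq> A}\<close>. It is superadditive, and
  splitting a subset of a countable union along the union gives the other inequality.\<close>

lemma finite_signed_measure_Jordan:
  assumes \<mu>: "finite_signed_measure M \<mu>"
  obtains p q where "finite_signed_measure M p" "finite_signed_measure M q"
    "\<And>A. A \<in> sets M \<Longrightarrow> 0 \<le> p A" "\<And>A. A \<in> sets M \<Longrightarrow> 0 \<le> q A"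
    "\<And>A. \<mu> A = p A - q A"
proof -
  have \<mu>0: "\<mu> {} = 0" using \<mu> by (simp add: finite_signed_measure_def)
  obtain K where K: "\<And>B. B \<in> sets M \<Longrightarrow> \<bar>\<mu> B\<bar> \<le> K"
    using finite_signed_measure_bounded[OF \<mu>] by blast
  define p where "p A = (SUP B\<in>{B \<in> sets M. B \<subseteq> A}. \<mu> B)" for A
  have bdd: "bdd_above (\<mu> ` {B \<in> sets M. B \<subseteq> A})" for A
    using K by (intro bdd_aboveI[of _ K]) (auto dest!: abs_le_D1)
  have up: "\<mu> B \<le> p A" if "B \<in> sets M" "B \<subseteq> A" for A B
    unfolding p_def by (rule cSUP_upper[OF _ bdd]) (use that in auto)
  have least: "p A \<le> c" if "\<And>B. B \<in> sets M \<Longrightarrow> B \<subseteq> A \<Longrightarrow> \<mu> B \<le> c" for A c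
    unfolding p_def by (rule cSUP_least) (use that in auto)
  have nonneg: "0 \<le> p A" for A using up[of "{}" A] \<mu>0 by simp
  have mono: "p A \<le> p B" if "A \<subseteq> B" for A B
    by (rule least) (use that up in blast)
  have p0: "p {} = 0"
    by (rule antisym[OF least nonneg]) (use \<mu>0 in auto)
  have super: "p A + p B \<le> p (A \<union> B)" if "A \<inter> B = {}" for A B
  proof -
    have "p A \<le> p (A \<union> B) - p B"
    proof (rule least)
      fix C assume C: "C \<in> sets M" "C \<subseteq> A"
      have "p B \<le> p (A \<union> B) - \<mu> C"
      proof (rule least)
        fix D assume D: "D \<in> sets M" "D \<subseteq> B"
        have "\<mu> (C \<union> D) = \<mu> C + \<mu> D"
          by (rule finite_signed_measure_Un[OF \<mu>]) (use C D that in auto)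
        moreover have "\<mu> (C \<union> D) \<le> p (A \<union> B)" by (rule up) (use C D in auto)
        ultimately show "\<mu> D \<le> p (A \<union> B) - \<mu> C" by linarith
      qed
      then show "\<mu> C \<le> p (A \<union> B) - p B" by linarith
    qed
    then show ?thesis by linarith
  qed
  have "finite_signed_measure M p"
    unfolding finite_signed_measure_def
  proof (intro conjI allI impI)
    fix A :: "nat \<Rightarrow> _" assume A: "range A \<subseteq> sets M" and dis: "disjoint_family A"
    have "(\<Sum>i<n. p (A i)) \<le> p (\<Union>i<n. A i)" for n
    proof (induction n)
      case 0 then show ?case by (simp add: p0)
    next
      case (Suc n)
      have "A i \<inter> A n = {}" if "i < n" for i
        by (rule disjoint_family_onD[OF dis]) (use that in auto)
      then have "(\<Union>i<n. A i) \<inter> A n = {}"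
        by blast
      from super[OF this] Suc show ?case
        by (simp add: lessThan_Suc Un_commute)
    qed
    then have part: "(\<Sum>i<n. p (A i)) \<le> p (\<Union>i. A i)" for n
      by (rule order_trans) (auto intro!: mono)
    have "summable (\<lambda>i. p (A i))"
      by (rule summableI_nonneg_bounded[where x = "p (\<Union>i. A i)"]) (use nonneg part in auto)
    moreover have "suminf (\<lambda>i. p (A i)) \<le> p (\<Union>i. A i)"
      by (rule suminf_le_const[OF \<open>summable _\<close> part])
    moreover have "p (\<Union>i. A i) \<le> suminf (\<lambda>i. p (A i))"
    proof (rule least)
      fix B assume B: "B \<in> sets M" "B \<subseteq> (\<Union>i. A i)"
      have "(\<lambda>i. \<mu> (A i \<inter> B)) sums \<mu> (\<Union>i. A i \<inter> B)"
        using A B by (intro finite_signed_measure_sums[OF \<mu>] disjoint_family_subset[OF dis]) auto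
      moreover have "(\<Union>i. A i \<inter> B) = B" using B by blast
      ultimately have s: "(\<lambda>i. \<mu> (A i \<inter> B)) sums \<mu> B" by simp
      have "\<mu> (A i \<inter> B) \<le> p (A i)" for i by (rule up) (use A B in auto)
      then show "\<mu> B \<le> suminf (\<lambda>i. p (A i))"
        using sums_le[OF _ s summable_sums[OF \<open>summable _\<close>]] by blast
    qed
    ultimately show "(\<lambda>i. p (A i)) sums p (\<Union>i. A i)"
      by (simp add: sums_iff)
  qed (rule p0)
  then show thesis
    using that[of p "\<lambda>A. p A - \<mu> A"] nonneg up \<mu>
    by (auto intro: finite_signed_measure_diff)
qed

lemma finite_signed_measure_imp_measure:
  assumes \<mu>: "finite_signed_measure M \<mu>" and nonneg: "\<And>A. A \<in> sets M \<Longrightarrow> 0 \<le> \<mu> A"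
  obtains P where "finite_measure P" "sets P = sets M"
    "\<And>A. A \<in> sets M \<Longrightarrow> emeasure P A = ennreal (\<mu> A)"
proof -
  define P where "P = measure_of (space M) (sets M) (\<lambda>A. ennreal (\<mu> A))"
  have "countably_additive (sets M) (\<lambda>A. ennreal (\<mu> A))"
    unfolding countably_additive_def
  proof (intro allI impI)
    fix A :: "nat \<Rightarrow> _" assume A: "range A \<subseteq> sets M" and "disjoint_family A"
    then have "(\<lambda>i. \<mu> (A i)) sums \<mu> (\<Union>i. A i)"
      by (intro finite_signed_measure_sums[OF \<mu>]) auto
    then show "(\<Sum>i. ennreal (\<mu> (A i))) = ennreal (\<mu> (\<Union> (range A)))"
      using A by (intro suminf_ennreal_eq nonneg) auto
  qed
  moreover have "positive (sets M) (\<lambda>A. ennreal (\<mu> A))"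
    using \<mu> by (simp add: positive_def finite_signed_measure_def)
  ultimately have em: "emeasure P A = ennreal (\<mu> A)" if "A \<in> sets M" for A
    unfolding P_def by (intro emeasure_measure_of_sigma that sets.sigma_algebra_axioms)
  moreover have "sets P = sets M"
    unfolding P_def by simp
  moreover from this have "finite_measure P"
    by (intro finite_measureI) (metis em ennreal_neq_top sets.top sets_eq_imp_space_eq infinity_ennreal_def)
  ultimately show thesis using that by blast
qed

section \<open>Vector densities\<close>

text \<open>The representation \<open>\<mu>(A) = \<integral>\<^sub>A f d\<sigma>\<close> through which all Lorenz hulls are
  handled.\<close>

definition has_density ::
  "'a measure \<Rightarrow> ('a set \<Rightarrow> real ^ 'n) \<Rightarrow> 'a measure \<Rightarrow> ('a \<Rightarrow> real ^ 'n) \<Rightarrow> bool" where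
  "has_density M \<mu> \<sigma> f \<longleftrightarrow> finite_measure \<sigma> \<and> sets \<sigma> = sets M \<and> integrable \<sigma> f \<and>
     (\<forall>A\<in>sets M. \<mu> A = (\<integral>x. indicator A x *\<^sub>R f x \<partial>\<sigma>))"

lemma measure_density_real:
  assumes "finite_measure \<sigma>" "finite_measure P" "sets P = sets \<sigma>" "absolutely_continuous \<sigma> P"
  obtains D :: "'a \<Rightarrow> real" where "integrable \<sigma> D"
    "\<And>A. A \<in> sets \<sigma> \<Longrightarrow> measure P A = (\<integral>x. indicator A x * D x \<partial>\<sigma>)"
proof -
  interpret \<sigma>: finite_measure \<sigma> by fact
  interpret P: finite_measure P by fact
  obtain D where D: "D \<in> borel_measurable \<sigma>"
    "AE x in \<sigma>. RN_deriv \<sigma> P x = ennreal (D x)" "\<And>x. 0 \<le> D x"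
    using \<sigma>.real_RN_deriv[OF assms(2,4,3)] by blast
  have P: "P = density \<sigma> (\<lambda>x. ennreal (D x))"
    using density_cong[OF borel_measurable_RN_deriv _ D(2)] D(1)
      \<sigma>.density_RN_deriv[OF assms(4,3)] by simp
  have ind: "(indicator A :: _ \<Rightarrow> real) \<in> borel_measurable \<sigma>" if "A \<in> sets \<sigma>" for A
    using that by simp
  have "integrable (density \<sigma> D) (\<lambda>x. 1 :: real)"
    using P.integrable_const[of "1::real"] P by simp
  then have "integrable \<sigma> D"
    using D by (subst (asm) integrable_density) auto
  moreover have "measure P A = (\<integral>x. indicator A x * D x \<partial>\<sigma>)" if "A \<in> sets \<sigma>" for A
  proof -
    have "measure P A = integral\<^sup>L P (indicator A)"
      using that assms(3) by (simp add: P.emeasure_finite less_top[symmetric])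
    also have "\<dots> = (\<integral>x. D x *\<^sub>R indicator A x \<partial>\<sigma>)"
      using P integral_density[OF ind[OF that] D(1)] D(3) by simp
    finally show ?thesis by (simp add: mult.commute)
  qed
  ultimately show thesis using that by blast
qed

text \<open>The sum of the positive and negative parts of all components dominates each of them, so
  one \<open>\<sigma>\<close> serves all components.\<close>

lemma signed_vector_measure_density:
  fixes \<mu> :: "'a set \<Rightarrow> real ^ 'n"
  assumes \<mu>: "signed_vector_measure M \<mu>"
  obtains \<sigma> f where "has_density M \<mu> \<sigma> f"
proof -
  have "\<exists>p q. finite_signed_measure M p \<and> finite_signed_measure M q \<and>
      (\<forall>A\<in>sets M. 0 \<le> p A) \<and> (\<forall>A\<in>sets M. 0 \<le> q A) \<and> (\<forall>A. \<mu> A $ i = p A - q A)" for i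
    using \<mu> finite_signed_measure_Jordan[of M "\<lambda>A. \<mu> A $ i"]
    unfolding signed_vector_measure_def by metis
  then obtain p q where pq: "\<And>i. finite_signed_measure M (p i)" "\<And>i. finite_signed_measure M (q i)"
      "\<And>i A. A \<in> sets M \<Longrightarrow> 0 \<le> p i A" "\<And>i A. A \<in> sets M \<Longrightarrow> 0 \<le> q i A"
      "\<And>i A. \<mu> A $ i = p i A - q i A"
    by metis
  define t where "t = (\<lambda>A. \<Sum>i\<in>UNIV. p i A + q i A)"
  have "finite_signed_measure M t"
    unfolding t_def by (intro finite_signed_measure_sum finite_signed_measure_add pq)
  moreover have "0 \<le> t A" if "A \<in> sets M" for A
    unfolding t_def using that pq by (intro sum_nonneg add_nonneg_nonneg)
  ultimately obtain \<sigma> where \<sigma>: "finite_measure \<sigma>" "sets \<sigma> = sets M"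
      "\<And>A. A \<in> sets M \<Longrightarrow> emeasure \<sigma> A = ennreal (t A)"
    using finite_signed_measure_imp_measure by metis
  have dens: "\<exists>D. integrable \<sigma> D \<and> (\<forall>A\<in>sets M. r A = (\<integral>x. indicator A x * D x \<partial>\<sigma>))"
    if r: "finite_signed_measure M r" "\<And>A. A \<in> sets M \<Longrightarrow> 0 \<le> r A" "\<And>A. A \<in> sets M \<Longrightarrow> r A \<le> t A"
    for r :: "'a set \<Rightarrow> real"
  proof -
    obtain P where P: "finite_measure P" "sets P = sets M"
        "\<And>A. A \<in> sets M \<Longrightarrow> emeasure P A = ennreal (r A)"
      using finite_signed_measure_imp_measure[OF r(1,2)] by metis
    have "absolutely_continuous \<sigma> P"
      unfolding absolutely_continuous_def null_sets_def
      using P(2,3) \<sigma>(2,3) r(2,3) by (auto simp: ennreal_eq_0_iff) (meson order_trans)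
    then obtain D where "integrable \<sigma> D"
        "\<And>A. A \<in> sets \<sigma> \<Longrightarrow> measure P A = (\<integral>x. indicator A x * D x \<partial>\<sigma>)"
      using measure_density_real[OF \<sigma>(1) P(1)] P(2) \<sigma>(2) by metis
    then show ?thesis using P(3) r(2) \<sigma>(2) by (auto simp: measure_def)
  qed
  have le: "p i A + q i A \<le> t A" if "A \<in> sets M" for i A
    unfolding t_def using that pq
    by (intro member_le_sum[of i UNIV "\<lambda>i. p i A + q i A"]) auto
  have "\<exists>D. integrable \<sigma> D \<and> (\<forall>A\<in>sets M. p i A = (\<integral>x. indicator A x * D x \<partial>\<sigma>))" for i
    using pq(4) le by (intro dens pq) (smt (verit))+
  then obtain F where F: "\<And>i. integrable \<sigma> (F i)"
      "\<And>i A. A \<in> sets M \<Longrightarrow> p i A = (\<integral>x. indicator A x * F i x \<partial>\<sigma>)" by metis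
  have "\<exists>D. integrable \<sigma> D \<and> (\<forall>A\<in>sets M. q i A = (\<integral>x. indicator A x * D x \<partial>\<sigma>))" for i
    using pq(3) le by (intro dens pq) (smt (verit))+
  then obtain G where G: "\<And>i. integrable \<sigma> (G i)"
      "\<And>i A. A \<in> sets M \<Longrightarrow> q i A = (\<integral>x. indicator A x * G i x \<partial>\<sigma>)" by metis
  define f :: "'a \<Rightarrow> real ^ 'n" where "f x = (\<Sum>i\<in>UNIV. (F i x - G i x) *\<^sub>R axis i 1)" for x
  have f: "f x $ i = F i x - G i x" for x i
    unfolding f_def by (simp add: axis_def if_distrib cong: if_cong)
  have int: "integrable \<sigma> f"
    unfolding f_def using F(1) G(1) by auto
  have "\<mu> A = (\<integral>x. indicator A x *\<^sub>R f x \<partial>\<sigma>)" if A: "A \<in> sets M" for A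
  proof -
    have A': "A \<in> sets \<sigma>" using A \<sigma> by simp
    have "(\<integral>x. indicator A x *\<^sub>R f x \<partial>\<sigma>) $ i = (\<integral>x. indicator A x * F i x - indicator A x * G i x \<partial>\<sigma>)" for i
      using integral_bounded_linear[OF bounded_linear_vec_nth[of i] integrable_mult_indicator[OF A' int]]
      by (simp add: f right_diff_distrib)
    also have "(\<integral>x. indicator A x * F i x - indicator A x * G i x \<partial>\<sigma>) = p i A - q i A" for i
      using F G A integrable_mult_indicator[OF A' F(1)] integrable_mult_indicator[OF A' G(1)]
      by (simp add: Bochner_Integration.integral_diff)
    finally show ?thesis by (simp add: vec_eq_iff pq(5))
  qed
  then have "has_density M \<mu> \<sigma> f"
    using \<sigma> int by (auto simp: has_density_def)
  then show thesis by (rule that)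
qed

section \<open>Lorenz hulls are closed\<close>

definition density_hull :: "'a measure \<Rightarrow> ('a \<Rightarrow> 'v::euclidean_space) \<Rightarrow> 'v set" where
  "density_hull \<sigma> f = convex hull ((\<lambda>A. \<integral>x. indicator A x *\<^sub>R f x \<partial>\<sigma>) ` sets \<sigma>)"

text \<open>Allowing fuzzy sets \<open>\<phi>\<close> in place of indicators gives a convex set whose elements are
  single integrals, to which convergence theorems apply; it turns out to be the hull itself.\<close>

definition fuzzy_range :: "'a measure \<Rightarrow> ('a \<Rightarrow> 'v::euclidean_space) \<Rightarrow> 'v set" where
  "fuzzy_range \<sigma> f = {\<integral>x. \<phi> x *\<^sub>R f x \<partial>\<sigma> |\<phi>.
     \<phi> \<in> borel_measurable \<sigma> \<and> (\<forall>x. 0 \<le> \<phi> x \<and> \<phi> x \<le> (1::real))}"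

lemma integrable_fuzzy:
  fixes f :: "'a \<Rightarrow> 'v::euclidean_space"
  assumes "integrable \<sigma> f" "\<phi> \<in> borel_measurable \<sigma>" "\<And>x. 0 \<le> \<phi> x \<and> \<phi> x \<le> (1::real)"
  shows "integrable \<sigma> (\<lambda>x. \<phi> x *\<^sub>R f x)"
proof (rule Bochner_Integration.integrable_bound[OF assms(1)])
  show "(\<lambda>x. \<phi> x *\<^sub>R f x) \<in> borel_measurable \<sigma>"
    using assms by measurable
  show "AE x in \<sigma>. norm (\<phi> x *\<^sub>R f x) \<le> norm (f x)"
    using assms(3) by (auto simp: mult_left_le_one_le)
qed

lemma range_subset_fuzzy_range:
  "A \<in> sets \<sigma> \<Longrightarrow> (\<integral>x. indicator A x *\<^sub>R f x \<partial>\<sigma>) \<in> fuzzy_range \<sigma> f"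
  unfolding fuzzy_range_def by (auto intro!: exI[of _ "indicator A"] simp: indicator_def)

lemma convex_fuzzy_range:
  assumes "integrable \<sigma> f"
  shows "convex (fuzzy_range \<sigma> f)"
proof (rule convexI)
  fix x y and a b :: real
  assume "x \<in> fuzzy_range \<sigma> f" "y \<in> fuzzy_range \<sigma> f" and ab: "0 \<le> a" "0 \<le> b" "a + b = 1"
  then obtain \<phi> \<psi> where \<phi>: "\<phi> \<in> borel_measurable \<sigma>" "\<And>x. 0 \<le> \<phi> x \<and> \<phi> x \<le> (1::real)"
      "x = (\<integral>x. \<phi> x *\<^sub>R f x \<partial>\<sigma>)"
    and \<psi>: "\<psi> \<in> borel_measurable \<sigma>" "\<And>x. 0 \<le> \<psi> x \<and> \<psi> x \<le> (1::real)"
      "y = (\<integral>x. \<psi> x *\<^sub>R f x \<partial>\<sigma>)"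
    unfolding fuzzy_range_def by auto
  have "a *\<^sub>R x + b *\<^sub>R y = (\<integral>x. (a * \<phi> x + b * \<psi> x) *\<^sub>R f x \<partial>\<sigma>)"
    using integrable_fuzzy[OF assms \<phi>(1,2)] integrable_fuzzy[OF assms \<psi>(1,2)] \<phi>(3) \<psi>(3)
    by (simp add: scaleR_add_left flip: scaleR_scaleR)
  moreover have "a * \<phi> x + b * \<psi> x \<le> 1" for x
    using convex_bound_le[of "\<phi> x" 1 "\<psi> x" a b] \<phi>(2) \<psi>(2) ab by simp
  moreover have "(\<lambda>x. a * \<phi> x + b * \<psi> x) \<in> borel_measurable \<sigma>"
    using \<phi>(1) \<psi>(1) by measurable
  ultimately show "a *\<^sub>R x + b *\<^sub>R y \<in> fuzzy_range \<sigma> f"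
    unfolding fuzzy_range_def using \<phi>(2) \<psi>(2) ab
    by (auto intro!: exI[of _ "\<lambda>x. a * \<phi> x + b * \<psi> x"])
qed

lemma density_hull_subset_fuzzy_range:
  "integrable \<sigma> f \<Longrightarrow> density_hull \<sigma> f \<subseteq> fuzzy_range \<sigma> f"
  unfolding density_hull_def
  by (rule hull_minimal) (auto simp: range_subset_fuzzy_range convex_fuzzy_range)

lemma integrable_face:
  fixes f :: "'a \<Rightarrow> 'v::euclidean_space" and u :: 'v
  assumes f: "integrable \<sigma> f"
  shows "integrable \<sigma> (\<lambda>x. if u \<bullet> f x = 0 then f x else 0)"
proof -
  have [measurable]: "f \<in> borel_measurable \<sigma>" using f by simp
  have "{x\<in>space \<sigma>. u \<bullet> f x = 0} \<in> sets \<sigma>" by measurable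
  from integrable_mult_indicator[OF this f] show ?thesis
    by (rule Bochner_Integration.integrable_cong[THEN iffD1, rotated 2])
      (auto simp: indicator_def)
qed

lemma inner_fuzzy_le:
  fixes f :: "'a \<Rightarrow> 'v::euclidean_space"
  assumes f: "integrable \<sigma> f" and "z \<in> fuzzy_range \<sigma> f"
  shows "u \<bullet> z \<le> (\<integral>x. max 0 (u \<bullet> f x) \<partial>\<sigma>)"
proof -
  obtain \<phi> where \<phi>: "\<phi> \<in> borel_measurable \<sigma>" "\<And>x. 0 \<le> \<phi> x \<and> \<phi> x \<le> (1::real)"
      "z = (\<integral>x. \<phi> x *\<^sub>R f x \<partial>\<sigma>)"
    using assms(2) unfolding fuzzy_range_def by auto
  have i: "integrable \<sigma> (\<lambda>x. \<phi> x *\<^sub>R f x)" by (rule integrable_fuzzy[OF f \<phi>(1,2)])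
  have "u \<bullet> z = (\<integral>x. u \<bullet> (\<phi> x *\<^sub>R f x) \<partial>\<sigma>)"
    unfolding \<phi>(3) by (rule integral_inner_right[symmetric]) (rule i)
  also have "\<dots> \<le> (\<integral>x. max 0 (u \<bullet> f x) \<partial>\<sigma>)"
  proof (rule integral_mono)
    show "integrable \<sigma> (\<lambda>x. max 0 (u \<bullet> f x))" using f by simp
    show "u \<bullet> \<phi> x *\<^sub>R f x \<le> max 0 (u \<bullet> f x)" for x
    proof (cases "u \<bullet> f x \<ge> 0")
      case True then show ?thesis using \<phi>(2)[of x] by (simp add: mult_left_le_one_le)
    next
      case False then show ?thesis using \<phi>(2)[of x] by (simp add: mult_nonneg_nonpos)
    qed
    show "integrable \<sigma> (\<lambda>x. u \<bullet> \<phi> x *\<^sub>R f x)" by (rule integrable_inner_right) (rule i)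
  qed
  finally show ?thesis .
qed

lemma integral_positive_part_set:
  fixes f :: "'a \<Rightarrow> 'v::euclidean_space" and u :: 'v
  assumes f: "integrable \<sigma> f"
  defines "P \<equiv> {x\<in>space \<sigma>. u \<bullet> f x > 0}"
  shows "P \<in> sets \<sigma>"
    and "u \<bullet> (\<integral>x. indicator P x *\<^sub>R f x \<partial>\<sigma>) = (\<integral>x. max 0 (u \<bullet> f x) \<partial>\<sigma>)"
proof -
  have [measurable]: "f \<in> borel_measurable \<sigma>" using f by simp
  show P: "P \<in> sets \<sigma>" unfolding P_def by measurable
  have "u \<bullet> (\<integral>x. indicator P x *\<^sub>R f x \<partial>\<sigma>) = (\<integral>x. u \<bullet> (indicator P x *\<^sub>R f x) \<partial>\<sigma>)"
    by (rule integral_inner_right[symmetric]) (rule integrable_mult_indicator[OF P f])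
  also have "\<dots> = (\<integral>x. max 0 (u \<bullet> f x) \<partial>\<sigma>)"
    by (rule Bochner_Integration.integral_cong) (auto simp: P_def indicator_def)
  finally show "u \<bullet> (\<integral>x. indicator P x *\<^sub>R f x \<partial>\<sigma>) = (\<integral>x. max 0 (u \<bullet> f x) \<partial>\<sigma>)" .
qed

lemma fuzzy_range_subset_subspace:
  fixes f :: "'a \<Rightarrow> 'v::euclidean_space"
  assumes f: "integrable \<sigma> f" and V: "subspace V" "\<And>x. f x \<in> V"
  shows "fuzzy_range \<sigma> f \<subseteq> V"
proof
  fix z assume "z \<in> fuzzy_range \<sigma> f"
  then obtain \<phi> where \<phi>: "\<phi> \<in> borel_measurable \<sigma>" "\<And>x. 0 \<le> \<phi> x \<and> \<phi> x \<le> (1::real)"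
      "z = (\<integral>x. \<phi> x *\<^sub>R f x \<partial>\<sigma>)"
    unfolding fuzzy_range_def by auto
  have "w \<bullet> z = 0" if "w \<in> V\<^sup>\<bottom>" for w
  proof -
    have "w \<bullet> f x = 0" for x
      using that V(2)[of x] by (auto simp: orthogonal_comp_def orthogonal_def inner_commute)
    moreover have "w \<bullet> z = (\<integral>x. w \<bullet> (\<phi> x *\<^sub>R f x) \<partial>\<sigma>)"
      unfolding \<phi>(3) by (rule integral_inner_right[symmetric]) (rule integrable_fuzzy[OF f \<phi>(1,2)])
    ultimately show ?thesis by simp
  qed
  then have "z \<in> V\<^sup>\<bottom>\<^sup>\<bottom>"
    by (auto simp: orthogonal_comp_def orthogonal_def)
  then show "z \<in> V" using orthogonal_comp_self[OF V(1)] by simp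
qed

text \<open>A fuzzy integral that nearly maximises \<open>u\<close> forces \<open>\<phi>\<close> to be nearly the indicator of
  \<open>{u \<bullet> f > 0}\<close> wherever \<open>u \<bullet> f \<noteq> 0\<close>. The limits that attain the maximum therefore
  come from the restriction of \<open>f\<close> to \<open>{u \<bullet> f = 0}\<close>.\<close>

lemma closure_fuzzy_range_face:
  fixes f :: "'a \<Rightarrow> 'v::euclidean_space" and u :: 'v
  assumes f: "integrable \<sigma> f" and z: "z \<in> closure (fuzzy_range \<sigma> f)"
    and max: "u \<bullet> z \<ge> (\<integral>x. max 0 (u \<bullet> f x) \<partial>\<sigma>)"
  defines "P \<equiv> {x\<in>space \<sigma>. u \<bullet> f x > 0}"
    and "f0 \<equiv> \<lambda>x. if u \<bullet> f x = 0 then f x else 0"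
  shows "z - (\<integral>x. indicator P x *\<^sub>R f x \<partial>\<sigma>) \<in> closure (fuzzy_range \<sigma> f0)"
proof -
  have fm [measurable]: "f \<in> borel_measurable \<sigma>" using f by simp
  have P [measurable]: "P \<in> sets \<sigma>"
    and uP: "u \<bullet> (\<integral>x. indicator P x *\<^sub>R f x \<partial>\<sigma>) = (\<integral>x. max 0 (u \<bullet> f x) \<partial>\<sigma>)"
    using integral_positive_part_set[OF f, of u] unfolding P_def by auto
  have f0: "integrable \<sigma> f0"
    unfolding f0_def by (rule integrable_face[OF f])
  obtain zs where zs: "\<And>k. zs k \<in> fuzzy_range \<sigma> f" "zs \<longlonglongrightarrow> z"
    using z unfolding closure_sequential by blast
  have "\<forall>k. \<exists>\<phi>. \<phi> \<in> borel_measurable \<sigma> \<and> (\<forall>x. 0 \<le> \<phi> x \<and> \<phi> x \<le> (1::real))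
      \<and> zs k = (\<integral>x. \<phi> x *\<^sub>R f x \<partial>\<sigma>)"
    using zs(1) unfolding fuzzy_range_def by blast
  then obtain \<phi> where \<phi> [measurable]: "\<And>k. \<phi> k \<in> borel_measurable \<sigma>"
    and \<phi>01: "\<And>k x. 0 \<le> \<phi> k x \<and> \<phi> k x \<le> (1::real)"
    and zs_eq: "\<And>k. zs k = (\<integral>x. \<phi> k x *\<^sub>R f x \<partial>\<sigma>)"
    by metis
  define d where "d k x = max 0 (u \<bullet> f x) - u \<bullet> (\<phi> k x *\<^sub>R f x)" for k x
  have d_eq: "norm (d k x) = d k x" for k x
    using \<phi>01[of k x] unfolding d_def
    by (auto simp: max_def mult_left_le_one_le mult_nonneg_nonpos)
  have i: "integrable \<sigma> (\<lambda>x. \<phi> k x *\<^sub>R f x)" for k by (rule integrable_fuzzy[OF f \<phi> \<phi>01])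
  have d: "integrable \<sigma> (d k)" for k
    unfolding d_def using f by (intro Bochner_Integration.integrable_diff integrable_inner_right i) auto
  have "(\<lambda>k. \<integral>x. norm (d k x) \<partial>\<sigma>) \<longlonglongrightarrow> 0"
  proof -
    have *: "(\<integral>x. norm (d k x) \<partial>\<sigma>) = (\<integral>x. max 0 (u \<bullet> f x) \<partial>\<sigma>) - u \<bullet> zs k" for k
      unfolding d_eq unfolding d_def zs_eq using i f by (simp del: inner_scaleR_right)
    have lim: "(\<lambda>k. \<integral>x. norm (d k x) \<partial>\<sigma>) \<longlonglongrightarrow> (\<integral>x. max 0 (u \<bullet> f x) \<partial>\<sigma>) - u \<bullet> z"
      unfolding * by (intro tendsto_intros zs)
    have "0 \<le> (\<integral>x. max 0 (u \<bullet> f x) \<partial>\<sigma>) - u \<bullet> z"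
      by (rule LIMSEQ_le_const[OF lim]) auto
    with max lim show ?thesis by simp
  qed
  then obtain r :: "nat \<Rightarrow> nat" where r: "strict_mono r"
      and lim: "AE x in \<sigma>. (\<lambda>k. d (r k) x) \<longlonglongrightarrow> 0"
    using tendsto_L1_AE_subseq[of \<sigma> d] d by blast
  have "(\<lambda>k. \<integral>x. \<phi> (r k) x *\<^sub>R (f x - f0 x) \<partial>\<sigma>) \<longlonglongrightarrow> (\<integral>x. indicator P x *\<^sub>R f x \<partial>\<sigma>)"
  proof (rule integral_dominated_convergence)
    show "(\<lambda>x. indicator P x *\<^sub>R f x) \<in> borel_measurable \<sigma>" by measurable
    show "(\<lambda>x. \<phi> (r k) x *\<^sub>R (f x - f0 x)) \<in> borel_measurable \<sigma>" for k
      using borel_measurable_integrable[OF f0] by measurable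
    show "integrable \<sigma> (\<lambda>x. norm (f x))" using f by simp
    show "AE x in \<sigma>. norm (\<phi> (r k) x *\<^sub>R (f x - f0 x)) \<le> norm (f x)" for k
      using \<phi>01[of "r k"] by (auto simp: f0_def mult_left_le_one_le)
    show "AE x in \<sigma>. (\<lambda>k. \<phi> (r k) x *\<^sub>R (f x - f0 x)) \<longlonglongrightarrow> indicator P x *\<^sub>R f x"
      using lim AE_space
    proof eventually_elim
      case (elim x)
      show ?case
      proof (cases "u \<bullet> f x = 0")
        case True
        then show ?thesis by (simp add: P_def f0_def)
      next
        case False
        have "d k x = (indicator P x - \<phi> k x) * (u \<bullet> f x)" for k
          using elim(2) False by (cases "u \<bullet> f x > 0") (auto simp: d_def P_def algebra_simps)
        then have "\<phi> k x = indicator P x - d k x / (u \<bullet> f x)" for k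
          using False by simp
        moreover have "(\<lambda>k. indicator P x - d (r k) x / (u \<bullet> f x)) \<longlonglongrightarrow> indicator P x - 0 / (u \<bullet> f x)"
          using False by (intro tendsto_intros elim(1))
        ultimately have "(\<lambda>k. \<phi> (r k) x) \<longlonglongrightarrow> indicator P x" by simp
        from tendsto_scaleR[OF this tendsto_const[of "f x"]] False show ?thesis
          by (simp add: f0_def)
      qed
    qed
  qed
  moreover have "(\<lambda>k. zs (r k)) \<longlonglongrightarrow> z"
    using LIMSEQ_subseq_LIMSEQ[OF zs(2) r] by (simp add: o_def)
  moreover have "(\<integral>x. \<phi> k x *\<^sub>R (f x - f0 x) \<partial>\<sigma>) = zs k - (\<integral>x. \<phi> k x *\<^sub>R f0 x \<partial>\<sigma>)" for k
    unfolding zs_eq using i integrable_fuzzy[OF f0 \<phi> \<phi>01] by (simp add: scaleR_diff_right)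
  ultimately have "(\<lambda>k. zs (r k) - (zs (r k) - (\<integral>x. \<phi> (r k) x *\<^sub>R f0 x \<partial>\<sigma>)))
      \<longlonglongrightarrow> z - (\<integral>x. indicator P x *\<^sub>R f x \<partial>\<sigma>)"
    by (intro tendsto_diff) auto
  then have "(\<lambda>k. \<integral>x. \<phi> (r k) x *\<^sub>R f0 x \<partial>\<sigma>) \<longlonglongrightarrow> z - (\<integral>x. indicator P x *\<^sub>R f x \<partial>\<sigma>)"
    by simp
  moreover have "(\<integral>x. \<phi> k x *\<^sub>R f0 x \<partial>\<sigma>) \<in> fuzzy_range \<sigma> f0" for k
    unfolding fuzzy_range_def using \<phi> \<phi>01 by blast
  ultimately show ?thesis
    unfolding closure_sequential
    by (intro exI[of _ "\<lambda>k. \<integral>x. \<phi> (r k) x *\<^sub>R f0 x \<partial>\<sigma>"]) simp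
qed

text \<open>A set of zero-\<open>u\<close> points can be adjoined to \<open>{u \<bullet> f > 0}\<close>, so the hull of the
  restricted density appears, translated, as a face of the full one.\<close>

lemma density_hull_face_subset:
  fixes f :: "'a \<Rightarrow> 'v::euclidean_space" and u :: 'v
  assumes f: "integrable \<sigma> f"
  defines "P \<equiv> {x\<in>space \<sigma>. u \<bullet> f x > 0}"
    and "f0 \<equiv> \<lambda>x. if u \<bullet> f x = 0 then f x else 0"
  shows "(+) (\<integral>x. indicator P x *\<^sub>R f x \<partial>\<sigma>) ` density_hull \<sigma> f0 \<subseteq> density_hull \<sigma> f"
  unfolding density_hull_def convex_hull_translation[symmetric]
proof (rule hull_mono, safe)
  have fm [measurable]: "f \<in> borel_measurable \<sigma>" using f by simp
  fix A assume [measurable]: "A \<in> sets \<sigma>"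
  have [measurable]: "P \<in> sets \<sigma>" unfolding P_def by measurable
  have f0: "integrable \<sigma> f0"
    unfolding f0_def by (rule integrable_face[OF f])
  define B where "B = P \<union> (A \<inter> {x\<in>space \<sigma>. u \<bullet> f x = 0})"
  have "B \<in> sets \<sigma>" unfolding B_def by measurable
  moreover have "(\<integral>x. indicator P x *\<^sub>R f x \<partial>\<sigma>) + (\<integral>x. indicator A x *\<^sub>R f0 x \<partial>\<sigma>)
      = (\<integral>x. indicator P x *\<^sub>R f x + indicator A x *\<^sub>R f0 x \<partial>\<sigma>)"
    by (rule Bochner_Integration.integral_add[symmetric];
        intro integrable_mult_indicator f f0; measurable)
  moreover have "\<dots> = (\<integral>x. indicator B x *\<^sub>R f x \<partial>\<sigma>)"
    by (rule Bochner_Integration.integral_cong) (auto simp: B_def P_def f0_def indicator_def)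
  ultimately show "(\<integral>x. indicator P x *\<^sub>R f x \<partial>\<sigma>) + (\<integral>x. indicator A x *\<^sub>R f0 x \<partial>\<sigma>)
      \<in> (\<lambda>A. \<integral>x. indicator A x *\<^sub>R f x \<partial>\<sigma>) ` sets \<sigma>"
    by auto
qed

text \<open>Induction on the dimension of a subspace \<open>V\<close> that contains the values of \<open>f\<close>. A limit
  point \<open>z\<close> outside the hull would be separated from it by some \<open>u \<in> V\<close>, hence would maximise
  \<open>u\<close>, and so would lie in a face whose density takes values in the smaller space
  \<open>V \<inter> u\<^sup>\<bottom>\<close>.\<close>

lemma closure_fuzzy_range_subset_density_hull:
  fixes f :: "'a \<Rightarrow> 'v::euclidean_space"
  assumes "integrable \<sigma> f" "subspace V" "\<And>x. f x \<in> V"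
  shows "closure (fuzzy_range \<sigma> f) \<subseteq> density_hull \<sigma> f"
  using assms
proof (induction "dim V" arbitrary: V f rule: less_induct)
  case less
  note f = less.prems(1) and V = less.prems(2,3)
  show ?case
  proof (rule subsetI, rule ccontr)
    fix z assume z: "z \<in> closure (fuzzy_range \<sigma> f)" and zn: "z \<notin> density_hull \<sigma> f"
    have "fuzzy_range \<sigma> f \<subseteq> V" by (rule fuzzy_range_subset_subspace[OF f V])
    then have "closure (fuzzy_range \<sigma> f) \<subseteq> V"
      by (simp add: closure_minimal closed_subspace V(1))
    then have zV: "z \<in> V" and hV: "density_hull \<sigma> f \<subseteq> V"
      using z \<open>fuzzy_range \<sigma> f \<subseteq> V\<close> density_hull_subset_fuzzy_range[OF f] by auto
    have ne: "density_hull \<sigma> f \<noteq> {}" and cv: "convex (density_hull \<sigma> f)"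
      unfolding density_hull_def by auto
    obtain a b where a: "z + a \<in> affine hull (insert z (density_hull \<sigma> f))" "a \<noteq> 0" "a \<bullet> z \<le> b"
        "\<And>x. x \<in> density_hull \<sigma> f \<Longrightarrow> a \<bullet> x \<ge> b"
      using separating_hyperplane_set_point_inaff[OF cv ne zn] by blast
    have "affine hull (insert z (density_hull \<sigma> f)) \<subseteq> V"
      using zV hV V(1) by (intro hull_minimal) (auto simp: subspace_imp_affine)
    then have "(z + a) - z \<in> V" using a(1) zV V(1) by (intro subspace_diff) auto
    then have aV: "a \<in> V" by simp
    define u where "u = - a"
    define P where "P = {x\<in>space \<sigma>. u \<bullet> f x > 0}"
    define f0 where "f0 = (\<lambda>x. if u \<bullet> f x = 0 then f x else 0)"
    define p where "p = (\<integral>x. indicator P x *\<^sub>R f x \<partial>\<sigma>)"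
    have "p \<in> density_hull \<sigma> f"
      unfolding p_def density_hull_def using integral_positive_part_set(1)[OF f, of u]
      by (intro hull_inc) (auto simp: P_def)
    then have "u \<bullet> z \<ge> u \<bullet> p"
      using a(3) a(4)[of p] by (simp add: u_def)
    then have "u \<bullet> z \<ge> (\<integral>x. max 0 (u \<bullet> f x) \<partial>\<sigma>)"
      unfolding p_def P_def integral_positive_part_set(2)[OF f] .
    from closure_fuzzy_range_face[OF f z this]
    have zf: "z - p \<in> closure (fuzzy_range \<sigma> f0)"
      by (simp add: p_def P_def f0_def)
    define V0 where "V0 = V \<inter> {x. u \<bullet> x = 0}"
    have V0: "subspace V0"
      unfolding V0_def by (intro subspace_inter V(1) subspace_hyperplane)
    have "u \<in> V" using aV V(1) by (simp add: u_def subspace_neg)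
    moreover have "u \<notin> V0" using a(2) by (simp add: V0_def u_def)
    ultimately have "V0 \<noteq> V" by blast
    then have "V0 \<subset> V" unfolding V0_def by blast
    then have "dim V0 < dim V"
      using V0 V(1) by (intro dim_psubset) (metis span_eq_iff)
    moreover have "integrable \<sigma> f0"
      unfolding f0_def by (rule integrable_face[OF f])
    moreover have "f0 x \<in> V0" for x
      using V by (auto simp: f0_def V0_def subspace_0)
    ultimately have "closure (fuzzy_range \<sigma> f0) \<subseteq> density_hull \<sigma> f0"
      using less.hyps V0 by blast
    with zf have "p + (z - p) \<in> (+) p ` density_hull \<sigma> f0" by blast
    also have "\<dots> \<subseteq> density_hull \<sigma> f"
      unfolding p_def P_def f0_def by (rule density_hull_face_subset[OF f])
    finally show False using zn by simp
  qed
qed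

lemma closed_density_hull:
  assumes "integrable \<sigma> f"
  shows "closed (density_hull \<sigma> f)"
proof -
  have "closure (density_hull \<sigma> f) \<subseteq> closure (fuzzy_range \<sigma> f)"
    by (intro closure_mono density_hull_subset_fuzzy_range assms)
  also have "\<dots> \<subseteq> density_hull \<sigma> f"
    by (rule closure_fuzzy_range_subset_density_hull[OF assms subspace_UNIV]) simp
  finally show ?thesis by (simp add: closure_subset_eq)
qed

text \<open>\<open>u \<mapsto> \<integral> max 0 (u \<bullet> f) d\<sigma>\<close> is the support function of the hull, and a closed
  convex set is determined by its support function.\<close>

lemma density_hull_mono_support:
  fixes f :: "'a \<Rightarrow> 'v::euclidean_space" and g :: "'b \<Rightarrow> 'v"
  assumes f: "integrable \<sigma> f" and g: "integrable \<tau> g"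
    and le: "\<And>u. (\<integral>x. max 0 (u \<bullet> f x) \<partial>\<sigma>) \<le> (\<integral>x. max 0 (u \<bullet> g x) \<partial>\<tau>)"
  shows "density_hull \<sigma> f \<subseteq> density_hull \<tau> g"
proof (rule subsetI, rule ccontr)
  fix z assume z: "z \<in> density_hull \<sigma> f" "z \<notin> density_hull \<tau> g"
  obtain a b where a: "a \<bullet> z < b" "\<And>x. x \<in> density_hull \<tau> g \<Longrightarrow> a \<bullet> x > b"
    using separating_hyperplane_closed_point[OF _ closed_density_hull[OF g] z(2)]
    unfolding density_hull_def by auto
  define P where "P = {x\<in>space \<tau>. - a \<bullet> g x > 0}"
  define p where "p = (\<integral>x. indicator P x *\<^sub>R g x \<partial>\<tau>)"
  have "p \<in> density_hull \<tau> g"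
    unfolding p_def density_hull_def P_def
    by (intro hull_inc imageI integral_positive_part_set(1)[OF g])
  have "- a \<bullet> z \<le> (\<integral>x. max 0 (- a \<bullet> f x) \<partial>\<sigma>)"
    using z(1) density_hull_subset_fuzzy_range[OF f] by (intro inner_fuzzy_le[OF f]) auto
  also have "\<dots> \<le> (\<integral>x. max 0 (- a \<bullet> g x) \<partial>\<tau>)" by (rule le)
  also have "\<dots> = - a \<bullet> p"
    unfolding p_def P_def by (rule integral_positive_part_set(2)[OF g, symmetric])
  also have "\<dots> < - b" using a(2)[OF \<open>p \<in> _\<close>] by simp
  finally show False using a(1) by simp
qed

lemma density_hull_eqI:
  assumes "integrable \<sigma> f" "integrable \<tau> g"
    and "\<And>u. (\<integral>x. max 0 (u \<bullet> f x) \<partial>\<sigma>) = (\<integral>x. max 0 (u \<bullet> g x) \<partial>\<tau>)"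
  shows "density_hull \<sigma> f = density_hull \<tau> g"
  using assms by (intro antisym density_hull_mono_support) auto

lemma density_hull_eqD:
  fixes f :: "'a \<Rightarrow> 'v::euclidean_space" and g :: "'b \<Rightarrow> 'v"
  assumes f: "integrable \<sigma> f" and g: "integrable \<tau> g" and eq: "density_hull \<sigma> f = density_hull \<tau> g"
  shows "(\<integral>x. max 0 (u \<bullet> f x) \<partial>\<sigma>) = (\<integral>x. max 0 (u \<bullet> g x) \<partial>\<tau>)"
proof -
  have *: "(\<integral>x. max 0 (u \<bullet> h x) \<partial>\<rho>) \<le> (\<integral>x. max 0 (u \<bullet> k x) \<partial>\<kappa>)"
    if h: "integrable \<rho> h" and k: "integrable \<kappa> k" and sub: "density_hull \<rho> h \<subseteq> density_hull \<kappa> k"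
    for \<rho> :: "'c measure" and \<kappa> :: "'d measure" and h k :: "_ \<Rightarrow> 'v"
  proof -
    let ?p = "\<integral>x. indicator {x\<in>space \<rho>. u \<bullet> h x > 0} x *\<^sub>R h x \<partial>\<rho>"
    have "?p \<in> density_hull \<rho> h"
      unfolding density_hull_def by (intro hull_inc imageI integral_positive_part_set(1)[OF h])
    then have "u \<bullet> ?p \<le> (\<integral>x. max 0 (u \<bullet> k x) \<partial>\<kappa>)"
      using sub density_hull_subset_fuzzy_range[OF k] by (intro inner_fuzzy_le[OF k]) auto
    then show ?thesis by (simp add: integral_positive_part_set(2)[OF h])
  qed
  show ?thesis using *[OF f g] *[OF g f] eq by auto
qed

lemma lorenz_hull_eq_density_hull:
  "has_density M \<mu> \<sigma> f \<Longrightarrow> lorenz_hull M \<mu> = density_hull \<sigma> f"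
  unfolding has_density_def lorenz_hull_def density_hull_def by (auto cong: image_cong)

section \<open>Products of vector measures\<close>

lemma has_densityD:
  assumes "has_density M \<mu> \<sigma> f"
  shows "finite_measure \<sigma>" "sets \<sigma> = sets M" "integrable \<sigma> f"
    "\<And>A. A \<in> sets M \<Longrightarrow> \<mu> A = (\<integral>x. indicator A x *\<^sub>R f x \<partial>\<sigma>)"
  using assms by (auto simp: has_density_def)

lemma has_density_nth:
  assumes "has_density M \<mu> \<sigma> f"
  shows "integrable \<sigma> (\<lambda>x. f x $ i)"
    and "A \<in> sets M \<Longrightarrow> \<mu> A $ i = (\<integral>x. indicator A x * f x $ i \<partial>\<sigma>)"
proof -
  note d = has_densityD[OF assms]
  show "integrable \<sigma> (\<lambda>x. f x $ i)"
    by (rule integrable_bounded_linear[OF bounded_linear_vec_nth d(3)])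
  assume "A \<in> sets M"
  then show "\<mu> A $ i = (\<integral>x. indicator A x * f x $ i \<partial>\<sigma>)"
    using integral_bounded_linear[OF bounded_linear_vec_nth[of i]
        integrable_mult_indicator[OF _ d(3), of A]] d(2,4) by simp
qed

lemma finite_signed_measure_density:
  fixes f :: "'a \<Rightarrow> real"
  assumes f: "integrable \<sigma> f" and sets: "sets \<sigma> = sets M"
    and eq: "\<And>A. A \<in> sets M \<Longrightarrow> \<mu> A = (\<integral>x. indicator A x * f x \<partial>\<sigma>)"
  shows "finite_signed_measure M \<mu>"
  unfolding finite_signed_measure_def
proof (intro conjI allI impI)
  show "\<mu> {} = 0" by (simp add: eq)
  fix A :: "nat \<Rightarrow> _" assume A: "range A \<subseteq> sets M" and dis: "disjoint_family A"
  have [measurable]: "A i \<in> sets \<sigma>" for i using A sets by auto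
  have [measurable]: "f \<in> borel_measurable \<sigma>" using f by simp
  have int: "integrable \<sigma> (\<lambda>x. indicator (A i) x * f x)" for i
    using integrable_mult_indicator[OF _ f, of "A i"] by simp
  have "(\<Sum>i<n. \<mu> (A i)) = (\<integral>x. indicator (\<Union>i<n. A i) x * f x \<partial>\<sigma>)" for n
  proof -
    have "(\<Sum>i<n. \<mu> (A i)) = (\<Sum>i<n. \<integral>x. indicator (A i) x * f x \<partial>\<sigma>)"
      using A by (intro sum.cong eq) auto
    also have "\<dots> = (\<integral>x. (\<Sum>i<n. indicator (A i) x * f x) \<partial>\<sigma>)"
      by (rule Bochner_Integration.integral_sum[symmetric]) (rule int)
    also have "\<dots> = (\<integral>x. indicator (\<Union>i<n. A i) x * f x \<partial>\<sigma>)"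
    proof (rule Bochner_Integration.integral_cong[OF refl])
      fix x
      have "indicator (\<Union>i<n. A i) x = (\<Sum>i<n. indicator (A i) x :: real)"
        using dis by (intro indicator_UN_disjoint) (auto intro: disjoint_family_on_mono)
      then show "(\<Sum>i<n. indicator (A i) x * f x) = indicator (\<Union>i<n. A i) x * f x"
        by (simp add: sum_distrib_right)
    qed
    finally show ?thesis .
  qed
  moreover have "(\<lambda>n. \<integral>x. indicator (\<Union>i<n. A i) x * f x \<partial>\<sigma>)
      \<longlonglongrightarrow> (\<integral>x. indicator (\<Union>i. A i) x * f x \<partial>\<sigma>)"
  proof (rule integral_dominated_convergence)
    show "integrable \<sigma> (\<lambda>x. norm (f x))" using f by simp
    show "AE x in \<sigma>. (\<lambda>n. indicator (\<Union>i<n. A i) x * f x) \<longlonglongrightarrow> indicator (\<Union>i. A i) x * f x"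
      by (intro AE_I2 tendsto_mult_right LIMSEQ_indicator_UN)
    show "AE x in \<sigma>. norm (indicator (\<Union>i<n. A i) x * f x) \<le> norm (f x)" for n
      by (auto simp: indicator_def)
  qed measurable
  ultimately show "(\<lambda>i. \<mu> (A i)) sums \<mu> (\<Union>i. A i)"
    using A by (simp add: sums_def eq)
qed

lemma has_density_signed_vector_measure:
  "has_density M \<mu> \<sigma> f \<Longrightarrow> signed_vector_measure M \<mu>"
  unfolding signed_vector_measure_def
  by (intro allI finite_signed_measure_density[OF has_density_nth(1)])
    (auto simp: has_densityD(2) has_density_nth(2))

text \<open>The measurable rectangles form an intersection-stable generator that contains the whole
  space.\<close>

lemma finite_signed_measure_eq_rectangles:
  assumes \<pi>: "finite_signed_measure (M \<Otimes>\<^sub>M N) \<pi>" and \<rho>: "finite_signed_measure (M \<Otimes>\<^sub>M N) \<rho>"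
    and eq: "\<And>A B. A \<in> sets M \<Longrightarrow> B \<in> sets N \<Longrightarrow> \<pi> (A \<times> B) = \<rho> (A \<times> B)"
    and C: "C \<in> sets (M \<Otimes>\<^sub>M N)"
  shows "\<pi> C = \<rho> C"
proof -
  have s: "sigma_sets (space M \<times> space N) {a \<times> b |a b. a \<in> sets M \<and> b \<in> sets N} = sets (M \<Otimes>\<^sub>M N)"
    by (rule sets_pair_measure[symmetric])
  have top: "space M \<times> space N \<in> sets (M \<Otimes>\<^sub>M N)"
    by (simp flip: space_pair_measure)
  show ?thesis
    using Int_stable_pair_measure_generator pair_measure_closed C[folded s]
  proof (induction rule: sigma_sets_induct_disjoint)
    case (basic C) then show ?case using eq by auto
  next
    case empty show ?case using \<pi> \<rho> by (simp add: finite_signed_measure_def)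
  next
    case (compl C)
    then have "C \<in> sets (M \<Otimes>\<^sub>M N)" by (simp add: s)
    moreover from this have "C \<subseteq> space M \<times> space N"
      using sets.sets_into_space by (fastforce simp: space_pair_measure)
    ultimately show ?case
      using compl eq[of "space M" "space N"]
      by (simp add: finite_signed_measure_Diff[OF \<pi> top] finite_signed_measure_Diff[OF \<rho> top])
  next
    case (union C)
    have C: "C i \<in> sets (M \<Otimes>\<^sub>M N)" for i using union(2) s by auto
    have "(\<lambda>i. \<pi> (C i)) sums \<pi> (\<Union>i. C i)" "(\<lambda>i. \<rho> (C i)) sums \<rho> (\<Union>i. C i)"
      by (rule finite_signed_measure_sums; fact)+
    then show ?case using union(3) by (simp add: sums_unique2)
  qed
qed

lemma bounded_bilinear_vec_times:
  "bounded_bilinear ((*) :: real ^ 'n \<Rightarrow> real ^ 'n \<Rightarrow> real ^ 'n)"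
  unfolding bilinear_conv_bounded_bilinear[symmetric] bilinear_def
  by (auto intro!: linearI simp: vec_eq_iff algebra_simps)

lemma inner_vec_times:
  fixes u x y :: "real ^ 'n"
  shows "u \<bullet> (x * y) = (u * y) \<bullet> x"
  by (simp add: inner_vec_def mult_ac)

lemma integrable_pair_bilinear:
  fixes f :: "'a \<Rightarrow> 'u::euclidean_space" and g :: "'b \<Rightarrow> 'v::euclidean_space"
    and h :: "'u \<Rightarrow> 'v \<Rightarrow> 'w::euclidean_space"
  assumes "finite_measure \<sigma>" "finite_measure \<tau>" and f: "integrable \<sigma> f" and g: "integrable \<tau> g"
    and h: "bounded_bilinear h"
  shows "integrable (\<sigma> \<Otimes>\<^sub>M \<tau>) (\<lambda>p. h (f (fst p)) (g (snd p)))"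
proof -
  interpret \<sigma>: finite_measure \<sigma> by fact
  interpret \<tau>: finite_measure \<tau> by fact
  interpret pair_sigma_finite \<sigma> \<tau> ..
  interpret h: bounded_bilinear h by fact
  have [measurable]: "f \<in> borel_measurable \<sigma>" "g \<in> borel_measurable \<tau>"
    using f g by auto
  have cont: "continuous_on UNIV (\<lambda>p. h (fst p) (snd p))"
    by (rule h.continuous_on[OF continuous_on_fst[OF continuous_on_id] continuous_on_snd[OF continuous_on_id]])
  obtain K where K: "\<And>a b. norm (h a b) \<le> norm a * norm b * K"
    using h.bounded by blast
  have "integrable (\<sigma> \<Otimes>\<^sub>M \<tau>) (\<lambda>p. norm (f (fst p)) * norm (g (snd p)) * K)"
    by (rule Fubini_integrable) (measurable, use f g in \<open>simp_all add: abs_mult\<close>)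
  moreover have "(\<lambda>p. h (f (fst p)) (g (snd p))) \<in> borel_measurable (\<sigma> \<Otimes>\<^sub>M \<tau>)"
    by (rule borel_measurable_continuous_Pair[OF _ _ cont]) measurable
  ultimately show ?thesis
    by (rule Bochner_Integration.integrable_bound) (use K in \<open>auto intro: order_trans[OF _ abs_ge_self]\<close>)
qed

lemma signed_prod_density:
  fixes f :: "'a \<Rightarrow> real" and g :: "'b \<Rightarrow> real"
  assumes \<sigma>: "finite_measure \<sigma>" "sets \<sigma> = sets M" "integrable \<sigma> f"
      "\<And>A. A \<in> sets M \<Longrightarrow> \<mu> A = (\<integral>x. indicator A x * f x \<partial>\<sigma>)"
    and \<tau>: "finite_measure \<tau>" "sets \<tau> = sets N" "integrable \<tau> g"
      "\<And>B. B \<in> sets N \<Longrightarrow> \<nu> B = (\<integral>y. indicator B y * g y \<partial>\<tau>)"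
    and C: "C \<in> sets (M \<Otimes>\<^sub>M N)"
  shows "signed_prod M \<mu> N \<nu> C = (\<integral>p. indicator C p * (f (fst p) * g (snd p)) \<partial>(\<sigma> \<Otimes>\<^sub>M \<tau>))"
proof -
  interpret \<sigma>: finite_measure \<sigma> by fact
  interpret \<tau>: finite_measure \<tau> by fact
  interpret pair_sigma_finite \<sigma> \<tau> ..
  have sets: "sets (\<sigma> \<Otimes>\<^sub>M \<tau>) = sets (M \<Otimes>\<^sub>M N)"
    by (rule sets_pair_measure_cong[OF \<sigma>(2) \<tau>(2)])
  have fg: "integrable (\<sigma> \<Otimes>\<^sub>M \<tau>) (\<lambda>p. f (fst p) * g (snd p))"
    by (rule integrable_pair_bilinear[OF \<sigma>(1) \<tau>(1) \<sigma>(3) \<tau>(3) bounded_bilinear_mult])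
  define \<rho> where "\<rho> C = (if C \<in> sets (M \<Otimes>\<^sub>M N)
    then \<integral>p. indicator C p * (f (fst p) * g (snd p)) \<partial>(\<sigma> \<Otimes>\<^sub>M \<tau>) else 0)" for C
  have \<rho>: "finite_signed_measure (M \<Otimes>\<^sub>M N) \<rho>"
    by (rule finite_signed_measure_density[OF fg sets]) (simp add: \<rho>_def)
  have rect: "\<rho> (A \<times> B) = \<mu> A * \<nu> B" if A: "A \<in> sets M" and B: "B \<in> sets N" for A B
  proof -
    have AB: "A \<times> B \<in> sets (\<sigma> \<Otimes>\<^sub>M \<tau>)" using A B \<sigma>(2) \<tau>(2) by auto
    have "\<rho> (A \<times> B) = (\<integral>p. indicator (A \<times> B) p * (f (fst p) * g (snd p)) \<partial>(\<sigma> \<Otimes>\<^sub>M \<tau>))"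
      using A B by (simp add: \<rho>_def)
    also have "\<dots> = (\<integral>x. \<integral>y. indicator (A \<times> B) (x, y) * (f x * g y) \<partial>\<tau> \<partial>\<sigma>)"
      using integral_fst'[OF integrable_mult_indicator[OF AB fg]] by simp
    also have "\<dots> = (\<integral>x. \<integral>y. (indicator A x * f x) * (indicator B y * g y) \<partial>\<tau> \<partial>\<sigma>)"
      by (simp add: indicator_times mult_ac)
    also have "\<dots> = \<mu> A * \<nu> B"
      using \<sigma>(4)[OF A] \<tau>(4)[OF B] by simp
    finally show ?thesis .
  qed
  have "signed_prod M \<mu> N \<nu> = \<rho>"
    unfolding signed_prod_def
  proof (rule the_equality)
    fix \<pi> assume \<pi>: "finite_signed_measure (M \<Otimes>\<^sub>M N) \<pi> \<and>
      (\<forall>A\<in>sets M. \<forall>B\<in>sets N. \<pi> (A \<times> B) = \<mu> A * \<nu> B) \<and> (\<forall>C. C \<notin> sets (M \<Otimes>\<^sub>M N) \<longrightarrow> \<pi> C = 0)"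
    show "\<pi> = \<rho>"
    proof
      fix C show "\<pi> C = \<rho> C"
        using finite_signed_measure_eq_rectangles[OF _ \<rho>, of \<pi> C] \<pi> rect
        by (cases "C \<in> sets (M \<Otimes>\<^sub>M N)") (auto simp: \<rho>_def)
    qed
  qed (use \<rho> rect in \<open>auto simp: \<rho>_def\<close>)
  then show ?thesis using C by (simp add: \<rho>_def)
qed

lemma has_density_vector_prod:
  fixes f :: "'a \<Rightarrow> real ^ 'n" and g :: "'b \<Rightarrow> real ^ 'n"
  assumes f: "has_density M \<alpha> \<sigma> f" and g: "has_density N \<beta> \<tau> g"
  shows "has_density (M \<Otimes>\<^sub>M N) (vector_prod M \<alpha> N \<beta>) (\<sigma> \<Otimes>\<^sub>M \<tau>) (\<lambda>p. f (fst p) * g (snd p))"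
  unfolding has_density_def
proof (intro conjI ballI)
  note F = has_densityD[OF f] and G = has_densityD[OF g]
  interpret \<sigma>: finite_measure \<sigma> by fact
  interpret \<tau>: finite_measure \<tau> by fact
  show "finite_measure (\<sigma> \<Otimes>\<^sub>M \<tau>)"
    by (rule finite_measure_pair_measure; fact)
  show sets: "sets (\<sigma> \<Otimes>\<^sub>M \<tau>) = sets (M \<Otimes>\<^sub>M N)"
    by (rule sets_pair_measure_cong[OF F(2) G(2)])
  show fg: "integrable (\<sigma> \<Otimes>\<^sub>M \<tau>) (\<lambda>p. f (fst p) * g (snd p))"
    by (rule integrable_pair_bilinear[OF F(1) G(1) F(3) G(3) bounded_bilinear_vec_times])
  fix C assume C: "C \<in> sets (M \<Otimes>\<^sub>M N)"
  have "(\<integral>p. indicator C p *\<^sub>R (f (fst p) * g (snd p)) \<partial>(\<sigma> \<Otimes>\<^sub>M \<tau>)) $ i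
      = (\<integral>p. indicator C p * (f (fst p) $ i * g (snd p) $ i) \<partial>(\<sigma> \<Otimes>\<^sub>M \<tau>))" for i
    using integral_bounded_linear[OF bounded_linear_vec_nth[of i]
        integrable_mult_indicator[OF _ fg, of C]] C sets by simp
  moreover have "signed_prod M (\<lambda>A. \<alpha> A $ i) N (\<lambda>B. \<beta> B $ i) C
      = (\<integral>p. indicator C p * (f (fst p) $ i * g (snd p) $ i) \<partial>(\<sigma> \<Otimes>\<^sub>M \<tau>))" for i
    by (rule signed_prod_density[OF F(1,2) has_density_nth[OF f] G(1,2) has_density_nth[OF g] C])
  ultimately show "vector_prod M \<alpha> N \<beta> C = (\<integral>p. indicator C p *\<^sub>R (f (fst p) * g (snd p)) \<partial>(\<sigma> \<Otimes>\<^sub>M \<tau>))"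
    by (simp add: vector_prod_def vec_eq_iff)
qed

section \<open>The Lorenz product\<close>

definition support :: "'a measure \<Rightarrow> ('a \<Rightarrow> 'v::euclidean_space) \<Rightarrow> 'v \<Rightarrow> real" where
  "support \<sigma> f u = (\<integral>x. max 0 (u \<bullet> f x) \<partial>\<sigma>)"

lemma lorenz_hull_eq_iff_support:
  assumes f: "has_density M \<mu> \<sigma> f" and g: "has_density N \<nu> \<tau> g"
  shows "lorenz_hull M \<mu> = lorenz_hull N \<nu> \<longleftrightarrow> support \<sigma> f = support \<tau> g"
  unfolding lorenz_hull_eq_density_hull[OF f] lorenz_hull_eq_density_hull[OF g] support_def fun_eq_iff
  using density_hull_eqI density_hull_eqD has_densityD(3)[OF f] has_densityD(3)[OF g] by metis

text \<open>By Fubini, the support function of a product is an average of the support function of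
  either factor, at arguments that involve only the density of the other.\<close>

lemma support_prod:
  fixes f :: "'a \<Rightarrow> real ^ 'n" and g :: "'b \<Rightarrow> real ^ 'n"
  assumes f: "has_density M \<alpha> \<sigma> f" and g: "has_density N \<beta> \<tau> g"
  defines "h \<equiv> \<lambda>p. f (fst p) * g (snd p)"
  shows "support (\<sigma> \<Otimes>\<^sub>M \<tau>) h u = (\<integral>y. support \<sigma> f (u * g y) \<partial>\<tau>)"
    and "support (\<sigma> \<Otimes>\<^sub>M \<tau>) h u = (\<integral>x. support \<tau> g (u * f x) \<partial>\<sigma>)"
    and "integrable \<sigma> (\<lambda>x. support \<tau> g (u * f x))"
proof -
  note F = has_densityD[OF f] and G = has_densityD[OF g]
  interpret \<sigma>: finite_measure \<sigma> by fact
  interpret \<tau>: finite_measure \<tau> by fact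
  interpret pair_sigma_finite \<sigma> \<tau> ..
  have "integrable (\<sigma> \<Otimes>\<^sub>M \<tau>) h"
    unfolding h_def using has_densityD(3)[OF has_density_vector_prod[OF f g]] .
  then have int: "integrable (\<sigma> \<Otimes>\<^sub>M \<tau>) (\<lambda>p. max 0 (u \<bullet> h p))" by simp
  have eq: "u \<bullet> (f x * g y) = (u * f x) \<bullet> g y" for x y
    by (metis inner_vec_times mult.commute)
  show "support (\<sigma> \<Otimes>\<^sub>M \<tau>) h u = (\<integral>x. support \<tau> g (u * f x) \<partial>\<sigma>)"
    using integral_fst'[OF int] by (simp add: support_def h_def flip: eq)
  show "integrable \<sigma> (\<lambda>x. support \<tau> g (u * f x))"
    using integrable_fst'[OF int] by (simp add: support_def h_def flip: eq)
  have "integrable (\<sigma> \<Otimes>\<^sub>M \<tau>) (\<lambda>(x, y). max 0 (u \<bullet> h (x, y)))"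
    using int by (simp add: case_prod_unfold)
  from integral_snd[OF this]
  show "support (\<sigma> \<Otimes>\<^sub>M \<tau>) h u = (\<integral>y. support \<sigma> f (u * g y) \<partial>\<tau>)"
    by (simp add: support_def h_def inner_vec_times[of u "f _"] case_prod_unfold)
qed

lemma lorenz_hull_prod_cong:
  fixes \<alpha> :: "'a set \<Rightarrow> real ^ 'n" and \<alpha>' :: "'c set \<Rightarrow> real ^ 'n"
    and \<beta> :: "'b set \<Rightarrow> real ^ 'n" and \<beta>' :: "'d set \<Rightarrow> real ^ 'n"
  assumes "signed_vector_measure M \<alpha>" "signed_vector_measure M' \<alpha>'"
    "signed_vector_measure N \<beta>" "signed_vector_measure N' \<beta>'"
    and eq: "lorenz_hull M \<alpha> = lorenz_hull M' \<alpha>'" "lorenz_hull N \<beta> = lorenz_hull N' \<beta>'"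
  shows "lorenz_hull (M \<Otimes>\<^sub>M N) (vector_prod M \<alpha> N \<beta>)
    = lorenz_hull (M' \<Otimes>\<^sub>M N') (vector_prod M' \<alpha>' N' \<beta>')"
proof -
  obtain \<sigma> f where f: "has_density M \<alpha> \<sigma> f" using signed_vector_measure_density[OF assms(1)] .
  obtain \<sigma>' f' where f': "has_density M' \<alpha>' \<sigma>' f'" using signed_vector_measure_density[OF assms(2)] .
  obtain \<tau> g where g: "has_density N \<beta> \<tau> g" using signed_vector_measure_density[OF assms(3)] .
  obtain \<tau>' g' where g': "has_density N' \<beta>' \<tau>' g'" using signed_vector_measure_density[OF assms(4)] .
  have eq': "support \<sigma> f = support \<sigma>' f'" "support \<tau> g = support \<tau>' g'"
    using eq lorenz_hull_eq_iff_support[OF f f'] lorenz_hull_eq_iff_support[OF g g'] by auto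
  have "support (\<sigma> \<Otimes>\<^sub>M \<tau>) (\<lambda>p. f (fst p) * g (snd p))
      = support (\<sigma>' \<Otimes>\<^sub>M \<tau>') (\<lambda>p. f' (fst p) * g' (snd p))"
  proof
    fix u
    \<comment> \<open>Exchange the first factor, then the second, each time integrating over the other one.\<close>
    have "support (\<sigma> \<Otimes>\<^sub>M \<tau>) (\<lambda>p. f (fst p) * g (snd p)) u
        = support (\<sigma>' \<Otimes>\<^sub>M \<tau>) (\<lambda>p. f' (fst p) * g (snd p)) u"
      unfolding support_prod(1)[OF f g] support_prod(1)[OF f' g] eq' ..
    also have "\<dots> = support (\<sigma>' \<Otimes>\<^sub>M \<tau>') (\<lambda>p. f' (fst p) * g' (snd p)) u"
      unfolding support_prod(2)[OF f' g] support_prod(2)[OF f' g'] eq' ..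
    finally show "support (\<sigma> \<Otimes>\<^sub>M \<tau>) (\<lambda>p. f (fst p) * g (snd p)) u
        = support (\<sigma>' \<Otimes>\<^sub>M \<tau>') (\<lambda>p. f' (fst p) * g' (snd p)) u" .
  qed
  then show ?thesis
    using lorenz_hull_eq_iff_support[OF has_density_vector_prod[OF f g] has_density_vector_prod[OF f' g']]
    by simp
qed

lemma lorenz_hull_prod_commute:
  fixes \<alpha> :: "'a set \<Rightarrow> real ^ 'n" and \<beta> :: "'b set \<Rightarrow> real ^ 'n"
  assumes "signed_vector_measure M \<alpha>" "signed_vector_measure N \<beta>"
  shows "lorenz_hull (M \<Otimes>\<^sub>M N) (vector_prod M \<alpha> N \<beta>)
    = lorenz_hull (N \<Otimes>\<^sub>M M) (vector_prod N \<beta> M \<alpha>)"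
proof -
  obtain \<sigma> f where f: "has_density M \<alpha> \<sigma> f" using signed_vector_measure_density[OF assms(1)] .
  obtain \<tau> g where g: "has_density N \<beta> \<tau> g" using signed_vector_measure_density[OF assms(2)] .
  have "support (\<sigma> \<Otimes>\<^sub>M \<tau>) (\<lambda>p. f (fst p) * g (snd p)) = support (\<tau> \<Otimes>\<^sub>M \<sigma>) (\<lambda>p. g (fst p) * f (snd p))"
    by (rule ext) (simp only: support_prod(1)[OF f g] support_prod(2)[OF g f])
  then show ?thesis
    using lorenz_hull_eq_iff_support[OF has_density_vector_prod[OF f g] has_density_vector_prod[OF g f]]
    by simp
qed

text \<open>Both bracketings have the support function
  \<open>\<integral>\<integral>\<integral> max 0 (u \<bullet> (f * g * h)) d\<rho> d\<tau> d\<sigma>\<close>. As an iterated integral over the three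
  factors, it can be compared although the two product spaces differ.\<close>

lemma lorenz_hull_prod_assoc:
  fixes \<alpha> :: "'a set \<Rightarrow> real ^ 'n" and \<beta> :: "'b set \<Rightarrow> real ^ 'n" and \<gamma> :: "'c set \<Rightarrow> real ^ 'n"
  assumes "signed_vector_measure L \<alpha>" "signed_vector_measure M \<beta>" "signed_vector_measure N \<gamma>"
  shows "lorenz_hull ((L \<Otimes>\<^sub>M M) \<Otimes>\<^sub>M N) (vector_prod (L \<Otimes>\<^sub>M M) (vector_prod L \<alpha> M \<beta>) N \<gamma>)
    = lorenz_hull (L \<Otimes>\<^sub>M (M \<Otimes>\<^sub>M N)) (vector_prod L \<alpha> (M \<Otimes>\<^sub>M N) (vector_prod M \<beta> N \<gamma>))"
proof -
  obtain \<sigma> f where f: "has_density L \<alpha> \<sigma> f" using signed_vector_measure_density[OF assms(1)] .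
  obtain \<tau> g where g: "has_density M \<beta> \<tau> g" using signed_vector_measure_density[OF assms(2)] .
  obtain \<rho> h where h: "has_density N \<gamma> \<rho> h" using signed_vector_measure_density[OF assms(3)] .
  note fg = has_density_vector_prod[OF f g] and gh = has_density_vector_prod[OF g h]
  show ?thesis
    unfolding lorenz_hull_eq_iff_support[OF has_density_vector_prod[OF fg h] has_density_vector_prod[OF f gh]]
  proof
    fix u
    interpret \<sigma>: finite_measure \<sigma> by (rule has_densityD(1)[OF f])
    interpret \<tau>: finite_measure \<tau> by (rule has_densityD(1)[OF g])
    interpret pair_sigma_finite \<sigma> \<tau> ..
    have "support ((\<sigma> \<Otimes>\<^sub>M \<tau>) \<Otimes>\<^sub>M \<rho>) (\<lambda>p. f (fst (fst p)) * g (snd (fst p)) * h (snd p)) u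
        = (\<integral>p. support \<rho> h (u * (f (fst p) * g (snd p))) \<partial>(\<sigma> \<Otimes>\<^sub>M \<tau>))"
      by (rule support_prod(2)[OF fg h])
    also have "\<dots> = (\<integral>x. \<integral>y. support \<rho> h (u * f x * g y) \<partial>\<tau> \<partial>\<sigma>)"
      using integral_fst'[OF support_prod(3)[OF fg h]] by (simp add: mult.assoc)
    also have "\<dots> = (\<integral>x. support (\<tau> \<Otimes>\<^sub>M \<rho>) (\<lambda>p. g (fst p) * h (snd p)) (u * f x) \<partial>\<sigma>)"
      by (simp only: support_prod(2)[OF g h])
    also have "\<dots> = support (\<sigma> \<Otimes>\<^sub>M (\<tau> \<Otimes>\<^sub>M \<rho>)) (\<lambda>p. f (fst p) * (g (fst (snd p)) * h (snd (snd p)))) u"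
      by (rule support_prod(2)[OF f gh, symmetric])
    finally show "support ((\<sigma> \<Otimes>\<^sub>M \<tau>) \<Otimes>\<^sub>M \<rho>) (\<lambda>p. f (fst (fst p)) * g (snd (fst p)) * h (snd p)) u
      = support (\<sigma> \<Otimes>\<^sub>M (\<tau> \<Otimes>\<^sub>M \<rho>)) (\<lambda>p. f (fst p) * (g (fst (snd p)) * h (snd (snd p)))) u" .
  qed
qed

text \<open>The image of the measure under its density, with the identity as new density, has the
  same support function, since the latter depends only on the distribution of the density.\<close>

lemma lorenz_hull_on_vectors:
  fixes \<mu> :: "'a set \<Rightarrow> real ^ 'n"
  assumes "signed_vector_measure M \<mu>"
  obtains M' :: "(real ^ 'n) measure" and \<mu>'
  where "signed_vector_measure M' \<mu>'" "lorenz_hull M' \<mu>' = lorenz_hull M \<mu>"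
proof -
  obtain \<sigma> f where f: "has_density M \<mu> \<sigma> f" using signed_vector_measure_density[OF assms] .
  note F = has_densityD[OF f]
  interpret finite_measure \<sigma> by fact
  have fm [measurable]: "f \<in> borel_measurable \<sigma>" using F(3) by simp
  define \<tau> where "\<tau> = distr \<sigma> borel f"
  define \<mu>' where "\<mu>' B = (\<integral>x. indicator B x *\<^sub>R x \<partial>\<tau>)" for B
  have g: "has_density borel \<mu>' \<tau> (\<lambda>x. x)"
    unfolding has_density_def \<mu>'_def using F(3)
    by (auto simp: \<tau>_def integrable_distr_eq intro!: finite_measure_distr)
  have "support \<tau> (\<lambda>x. x) = support \<sigma> f"
    unfolding support_def \<tau>_def by (subst integral_distr) auto
  then show thesis
    using that[OF has_density_signed_vector_measure[OF g]] lorenz_hull_eq_iff_support[OF g f] by simp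
qed

lemma lorenz_prod_lorenz_hull:
  fixes \<alpha> :: "'a set \<Rightarrow> real ^ 'n" and \<beta> :: "'b set \<Rightarrow> real ^ 'n"
  assumes \<alpha>: "signed_vector_measure M \<alpha>" and \<beta>: "signed_vector_measure N \<beta>"
  shows "lorenz_hull M \<alpha> \<odot>\<^sub>L lorenz_hull N \<beta> = lorenz_hull (M \<Otimes>\<^sub>M N) (vector_prod M \<alpha> N \<beta>)"
proof -
  obtain M' :: "(real ^ 'n) measure" and \<alpha>'
    where \<alpha>': "signed_vector_measure M' \<alpha>'" "lorenz_hull M' \<alpha>' = lorenz_hull M \<alpha>"
    using lorenz_hull_on_vectors[OF \<alpha>] .
  obtain N' :: "(real ^ 'n) measure" and \<beta>'
    where \<beta>': "signed_vector_measure N' \<beta>'" "lorenz_hull N' \<beta>' = lorenz_hull N \<beta>"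
    using lorenz_hull_on_vectors[OF \<beta>] .
  show ?thesis
    unfolding lorenz_prod_def
  proof (rule the_equality, goal_cases)
    case 1
    show ?case
      using \<alpha>' \<beta>' lorenz_hull_prod_cong[OF \<alpha> \<alpha>'(1) \<beta> \<beta>'(1)] by metis
  next
    case (2 K)
    then show ?case using lorenz_hull_prod_cong[OF \<alpha> _ \<beta>] by metis
  qed
qed

lemma signed_vector_measure_vector_prod:
  assumes "signed_vector_measure M \<alpha>" "signed_vector_measure N \<beta>"
  shows "signed_vector_measure (M \<Otimes>\<^sub>M N) (vector_prod M \<alpha> N \<beta>)"
proof -
  obtain \<sigma> f where f: "has_density M \<alpha> \<sigma> f" using signed_vector_measure_density[OF assms(1)] .
  obtain \<tau> g where g: "has_density N \<beta> \<tau> g" using signed_vector_measure_density[OF assms(2)] .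
  show ?thesis
    by (rule has_density_signed_vector_measure[OF has_density_vector_prod[OF f g]])
qed

theorem mainTheorem5:
  fixes H1 H2 H3 :: "(real ^ 'n) set"
    and M1 :: "'a measure" and M2 :: "'b measure" and M3 :: "'c measure"
    and \<alpha>1 :: "'a set \<Rightarrow> real ^ 'n" and \<alpha>2 :: "'b set \<Rightarrow> real ^ 'n" and \<alpha>3 :: "'c set \<Rightarrow> real ^ 'n"
  assumes "signed_vector_measure M1 \<alpha>1" and "H1 = lorenz_hull M1 \<alpha>1"
    and "signed_vector_measure M2 \<alpha>2" and "H2 = lorenz_hull M2 \<alpha>2"
    and "signed_vector_measure M3 \<alpha>3" and "H3 = lorenz_hull M3 \<alpha>3"
  shows "H1 \<odot>\<^sub>L H2 = lorenz_hull (M1 \<Otimes>\<^sub>M M2) (vector_prod M1 \<alpha>1 M2 \<alpha>2) \<and>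
    H1 \<odot>\<^sub>L H2 = H2 \<odot>\<^sub>L H1 \<and>
    (H1 \<odot>\<^sub>L H2) \<odot>\<^sub>L H3 = H1 \<odot>\<^sub>L (H2 \<odot>\<^sub>L H3)"
proof -
  note a = assms(1,3,5) and H = assms(2,4,6)
  note prod = signed_vector_measure_vector_prod
  show ?thesis
    unfolding H lorenz_prod_lorenz_hull[OF a(1,2)] lorenz_prod_lorenz_hull[OF a(2,1)]
      lorenz_prod_lorenz_hull[OF a(2,3)] lorenz_prod_lorenz_hull[OF prod[OF a(1,2)] a(3)]
      lorenz_prod_lorenz_hull[OF a(1) prod[OF a(2,3)]]
    using lorenz_hull_prod_commute[OF a(1,2)] lorenz_hull_prod_assoc[OF a] by simp
qed

end
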